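(* Consider a production-destruction-rest system on $\mathbb R^d_{>0}$, let $\mathbf u^n>\mathbf 0$, let $\mathbf u(t)$ be the exact solution with $\mathbf u(t_n)=\mathbf u^n$, and consider a modified Patankar–Runge–Kutta scheme with stages $\mathbf u^{(1)},\dots,\mathbf u^{(s)}$ and update of the form $$u^{n+\gamma}_k=u_k^n + \Delta t\sum_{j=1}^s \bar b_j(\gamma)\left(r_k^P(\mathbf u^{(j)}) + \sum_{\nu=1}^d p_{k\nu}(\mathbf u^{(j)}) \frac{u_\nu^{n+\gamma}}{\bar\sigma_\nu(\gamma)}-\Bigl( r^D_k(\mathbf u^{(j)}) + \sum_{\nu=1}^d d_{k\nu}(\mathbf u^{(j)})\Bigr)\frac{u_k^{n+\gamma}}{\bar\sigma_k(\gamma)}\right),\quad k=1,\dots,d,$$ with $\bar b_j(\gamma)=\gamma b_j$, where the baseline method ($\gamma=1$, with $\mathbf u^{n+1}$ and $\boldsymbol\sigma=\bar{\boldsymbol\sigma}(1)$) is of order $p$, and $$\bar{\boldsymbol\sigma}(\gamma)=\mathbf u(t_n+\Delta t) +(\gamma-1)\bigl(\mathbf u(t_n+\Delta t)-\mathbf u(t_n)\bigr) +\mathcal O(\Delta t^p)$$ for all $\gamma$ in a neighborhood $V$ of $1$. Then $$\frac{u_\nu^{n+\gamma}}{\bar \sigma_\nu(\gamma)}= 1+\mathcal O(\Delta t^p)=\frac{u_\nu^{n+1}}{\sigma_\nu}+\mathcal O(\Delta t^p),\quad \nu=1,\dots,d,$$ and in particular, $$\mathbf u^{n+\gamma}=\mathbf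 u^{n+1}+(\gamma-1)(\mathbf u^{n+1}-\mathbf u^n) + \mathcal O(\Delta t^{p+1})$$ for all $\gamma\in V$.
   Context: A production-destruction-rest system is an autonomous system $u_k'=f_k(\mathbf u)=r^P_k(\mathbf u)-r^D_k(\mathbf u)+\sum_{\nu=1}^{d}(p_{k\nu}(\mathbf u)-d_{k\nu}(\mathbf u))$, $k=1,\dots,d$, with $p_{k\nu}=d_{\nu k}$, $p_{kk}=d_{kk}=0$, and $r^P_k,r^D_k,p_{k\nu},d_{k\nu}\ge 0$ on $\mathbb R^d_{>0}$; these functions are assumed sufficiently smooth. Inequalities between vectors are componentwise. A modified Patankar–Runge–Kutta (MPRK) scheme is based on an explicit $s$-stage Runge–Kutta method with nonnegative coefficients $a_{ij}$, $b_j$. Its stages are given, for $i=1,\dots,s$, by $$u_k^{(i)}=u_k^n+\Delta t\sum_{j=1}^{i-1}a_{ij}\left(r_k^P(\mathbf u^{(j)})+\sum_{\nu=1}^d p_{k\nu}(\mathbf u^{(j)})\frac{u_\nu^{(i)}}{\pi_\nu^{(i)}}-\Bigl(r_k^D(\mathbf u^{(j)})+\sum_{\nu=1}^d d_{k\nu}(\mathbf u^{(j)})\Bigr)\frac{u_k^{(i)}}{\pi_k^{(i)}}\right),$$ where the positive Patankar-weight denominators $\pi^{(i)}_\nu$ depend only on $\mathbf u^n,\mathbf u^{(1)},\dots,\mathbf u^{(i-1)}$. The stages do not depend on $\gamma$. The positive denominators $\bar\sigma_\nu(\gamma)$ do not depend on $\mathbf u^{n+\gamma}$. The baseline update $\mathbf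 u^{n+1}$ is the update of the claim with $\gamma=1$, using the denominators $\sigma_\nu=\bar\sigma_\nu(1)$. The baseline method has order $p$ if its local error satisfies $\mathbf u^{n+1}=\mathbf u(t_n+\Delta t)+\mathcal O(\Delta t^{p+1})$ for all such systems. $\mathcal O$-terms refer to $\Delta t\to0$.
   Formalization: The stage denominators π^(i) are additionally assumed to be continuous functions of u^n, u^(1), …, u^(i-1) on the positive orthant (without this, stages may approach the boundary and the claim can fail), and the order p is taken to be at least 1. *)

theory Defs
  imports
    "HOL-Analysis.Analysis"
    "HOL-Library.Landau_Symbols"
    "HOL-Library.Extended_Nat"
begin

(* The order "<" on real ^ 'n is not the strict componentwise order, hence this set. *)
definition pos_orthant :: "(real ^ 'n) set" where
  "pos_orthant = {x. \<forall>k. 0 < x $ k}"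

(* Intended for open S. *)
primrec Ck_on :: "nat \<Rightarrow> ('a::euclidean_space \<Rightarrow> real) \<Rightarrow> 'a set \<Rightarrow> bool" where
  "Ck_on 0 f S \<longleftrightarrow> continuous_on S f"
| "Ck_on (Suc k) f S \<longleftrightarrow>
     (\<exists>f'. (\<forall>x\<in>S. (f has_derivative f' x) (at x)) \<and> (\<forall>b\<in>Basis. Ck_on k (\<lambda>x. f' x b) S))"

(* Class C^m for m < \<infinity>, and C^infinity for m = \<infinity>. *)
definition smooth_on :: "enat \<Rightarrow> ('a::euclidean_space \<Rightarrow> real) \<Rightarrow> 'a set \<Rightarrow> bool" where
  "smooth_on m f S \<longleftrightarrow> (\<forall>k. enat k \<le> m \<longrightarrow> Ck_on k f S)"

(* prd F v $ k $ l and dst F v $ k $ l are the entries p_kl(v) and d_kl(v). *)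
record 'n pdrs =
  rprod :: "real ^ 'n \<Rightarrow> real ^ 'n"
  rdest :: "real ^ 'n \<Rightarrow> real ^ 'n"
  prd :: "real ^ 'n \<Rightarrow> real ^ 'n ^ 'n"
  dst :: "real ^ 'n \<Rightarrow> real ^ 'n ^ 'n"

definition pdr_system :: "enat \<Rightarrow> 'n::finite pdrs \<Rightarrow> bool" where
  "pdr_system m F \<longleftrightarrow>
     (\<forall>v\<in>pos_orthant. \<forall>k l.
        0 \<le> rprod F v $ k \<and> 0 \<le> rdest F v $ k \<and>
        0 \<le> prd F v $ k $ l \<and> 0 \<le> dst F v $ k $ l \<and>
        prd F v $ k $ l = dst F v $ l $ k \<and>
        prd F v $ k $ k = 0 \<and> dst F v $ k $ k = 0) \<and>
     (\<forall>k l.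
        smooth_on m (\<lambda>v. rprod F v $ k) pos_orthant \<and>
        smooth_on m (\<lambda>v. rdest F v $ k) pos_orthant \<and>
        smooth_on m (\<lambda>v. prd F v $ k $ l) pos_orthant \<and>
        smooth_on m (\<lambda>v. dst F v $ k $ l) pos_orthant)"

definition pdrs_rhs :: "'n::finite pdrs \<Rightarrow> real ^ 'n \<Rightarrow> real ^ 'n" where
  "pdrs_rhs F v =
     (\<chi> k. rprod F v $ k - rdest F v $ k + (\<Sum>l\<in>UNIV. prd F v $ k $ l - dst F v $ k $ l))"

definition exact_solution ::
    "'n::finite pdrs \<Rightarrow> real \<Rightarrow> real \<Rightarrow> real ^ 'n \<Rightarrow> (real \<Rightarrow> real ^ 'n) \<Rightarrow> bool" where
  "exact_solution F tn T un u \<longleftrightarrow>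
     0 < T \<and> u tn = un \<and>
     (\<forall>t\<in>{tn..tn + T}. u t \<in> pos_orthant \<and>
        (u has_vector_derivative pdrs_rhs F (u t)) (at t within {tn..tn + T}))"

(* Stages are indexed 1, ..., nstages.  pden M i un Y is the vector pi^(i) for u^n = un and
   u^(j) = Y j; sden M g F dt un is the vector sigma-bar(g).  The stages are determined by F, dt
   and un, so sden may depend on them as well, but it has no access to the new value
   u^(n+g).  pden depends neither on the system nor on the step size. *)
record 'n mprk =
  nstages :: nat
  acoeff :: "nat \<Rightarrow> nat \<Rightarrow> real"
  bcoeff :: "nat \<Rightarrow> real"
  bbar :: "real \<Rightarrow> nat \<Rightarrow> real"
  pden :: "nat \<Rightarrow> real ^ 'n \<Rightarrow> (nat \<Rightarrow> real ^ 'n) \<Rightarrow> real ^ 'n"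
  sden :: "real \<Rightarrow> 'n pdrs \<Rightarrow> real \<Rightarrow> real ^ 'n \<Rightarrow> real ^ 'n"

(* V is the set of admissible parameters gamma.  Continuity of pden refers to the product
   topology; as pden M i un Y depends on Y 1, ..., Y (i - 1) only, it is ordinary joint continuity
   in (u^n, u^(1), ..., u^(i-1)). *)
definition mprk_method :: "enat \<Rightarrow> real set \<Rightarrow> 'n::finite mprk \<Rightarrow> bool" where
  "mprk_method m V M \<longleftrightarrow>
     (\<forall>i\<in>{1..nstages M}. \<forall>j\<in>{1..<i}. 0 \<le> acoeff M i j) \<and>
     (\<forall>j\<in>{1..nstages M}. 0 \<le> bcoeff M j) \<and>
     (\<forall>i\<in>{1..nstages M}.
        (\<forall>un Y Z. (\<forall>j\<in>{1..<i}. Y j = Z j) \<longrightarrow> pden M i un Y = pden M i un Z) \<and>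
        (\<forall>un\<in>pos_orthant. \<forall>Y. (\<forall>j. Y j \<in> pos_orthant) \<longrightarrow> pden M i un Y \<in> pos_orthant) \<and>
        continuous_on (pos_orthant \<times> {Y. \<forall>j. Y j \<in> pos_orthant}) (\<lambda>(un, Y). pden M i un Y)) \<and>
     (\<forall>\<gamma>\<in>V. \<forall>F dt un. pdr_system m F \<and> 0 < dt \<and> un \<in> pos_orthant \<longrightarrow>
        sden M \<gamma> F dt un \<in> pos_orthant)"

(* k-th component of the Patankar-weighted right-hand side: coefficients evaluated at the
   stage value y, unknown v, Patankar-weight denominators s. *)
definition patankar_rhs ::
    "'n::finite pdrs \<Rightarrow> real ^ 'n \<Rightarrow> real ^ 'n \<Rightarrow> real ^ 'n \<Rightarrow> 'n \<Rightarrow> real" where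
  "patankar_rhs F y s v k =
     rprod F y $ k + (\<Sum>l\<in>UNIV. prd F y $ k $ l * (v $ l / s $ l))
       - (rdest F y $ k + (\<Sum>l\<in>UNIV. dst F y $ k $ l)) * (v $ k / s $ k)"

definition mprk_stages ::
    "'n::finite mprk \<Rightarrow> 'n pdrs \<Rightarrow> real \<Rightarrow> real ^ 'n \<Rightarrow> (nat \<Rightarrow> real ^ 'n) \<Rightarrow> bool" where
  "mprk_stages M F dt un Y \<longleftrightarrow>
     (\<forall>i\<in>{1..nstages M}. \<forall>k.
        Y i $ k = un $ k
          + dt * (\<Sum>j\<in>{1..<i}. acoeff M i j * patankar_rhs F (Y j) (pden M i un Y) (Y i) k))"

definition mprk_update ::
    "'n::finite mprk \<Rightarrow> real \<Rightarrow> 'n pdrs \<Rightarrow> real \<Rightarrow> real ^ 'n \<Rightarrow> (nat \<Rightarrow> real ^ 'n) \<Rightarrow> real ^ 'n \<Rightarrow> bool"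
  where
  "mprk_update M \<gamma> F dt un Y v \<longleftrightarrow>
     (\<forall>k. v $ k = un $ k
        + dt * (\<Sum>j\<in>{1..nstages M}.
            bbar M \<gamma> j * patankar_rhs F (Y j) (sden M \<gamma> F dt un) v k))"

(* Y dt and v dt are the stages and the baseline update (gamma = 1) for step size dt. *)
definition baseline_order :: "enat \<Rightarrow> 'n::finite mprk \<Rightarrow> nat \<Rightarrow> bool" where
  "baseline_order m M p \<longleftrightarrow>
     (\<forall>F un tn T u Y v.
        pdr_system m F \<longrightarrow> un \<in> pos_orthant \<longrightarrow> exact_solution F tn T un u \<longrightarrow>
        (\<forall>\<^sub>F dt in at_right 0. mprk_stages M F dt un (Y dt) \<and> mprk_update M 1 F dt un (Y dt) (v dt)) \<longrightarrow>
        (\<forall>k. (\<lambda>dt. v dt $ k - u (tn + dt) $ k) \<in> O[at_right 0](\<lambda>dt. dt ^ (p + 1))))"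

end

theory Submission
  imports Defs
begin

text \<open>
  The weighted right-hand side is affine in the ratios of unknown to denominator, so everything
  reduces to linear systems that are perturbations of order \<open>dt\<close> of the identity. Put
  \<open>Q k l = (\<Sum>j. b\<^sub>j * patankar_matrix F (Y j) k l)\<close>, \<open>R k = (\<Sum>j. b\<^sub>j * rprod F (Y j) $ k)\<close> and
  \<open>x g l = w g $ l / \<sigma> g $ l - 1\<close>. Because the weights are \<open>g * b\<^sub>j\<close> and the stages do not depend on
  \<open>g\<close>, the update with parameter \<open>g\<close> reads
  \<open>w g $ k = un $ k + dt * g * (R k + (\<Sum>l. Q k l * (1 + x g l)))\<close> with the \<^emph>\<open>same\<close> \<open>R\<close> and \<open>Q\<close> for
  every \<open>g\<close>. Subtracting \<open>\<gamma>\<close> times the baseline equation eliminates \<open>R\<close>: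

  \<open>w \<gamma> $ k - (w 1 $ k + (\<gamma> - 1) * (w 1 $ k - un $ k)) = dt * \<gamma> * (\<Sum>l. Q k l * (x \<gamma> l - x 1 l))\<close>.

  Call this the difference identity. The baseline has order \<open>p\<close>, hence \<open>w 1 = u (tn + dt) + O(dt ^ (p + 1))\<close>, and
  \<open>\<sigma> 1 = u (tn + dt) + O(dt ^ p)\<close>; dividing gives \<open>x 1 = O(dt ^ p)\<close>. The line through \<open>un\<close> and
  \<open>w 1\<close>, taken at \<open>\<gamma>\<close>, differs from \<open>\<sigma> \<gamma>\<close> by \<open>O(dt ^ p)\<close>. Inserting \<open>w \<gamma> = \<sigma> \<gamma> * (1 + x \<gamma>)\<close> into the
  difference identity therefore yields
  \<open>x \<gamma> k - dt * (\<Sum>l. \<gamma> / \<sigma> \<gamma> k * Q k l * x \<gamma> l) = O(dt ^ p)\<close>, and since the matrix is \<open>O(dt)\<close> the sum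
  can be absorbed (\<open>bigo_absorb_small_linear\<close>): \<open>x \<gamma> = O(dt ^ p)\<close>. Feeding this back into the
  difference identity gains the extra factor \<open>dt\<close> of the last claim.

  What makes this work is that \<open>Q\<close> and \<open>1 / \<sigma> \<gamma>\<close> stay bounded as \<open>dt\<close> tends to 0. The former
  needs that the stages do not approach the boundary of the orthant, where the coefficients may blow
  up. In fact every stage converges to \<open>un\<close> (\<open>stages_tendsto\<close>): by induction on the stage, the
  earlier stages converge, hence so do the continuous denominators, and the implicit equation for the
  new stage is again a linear system with an \<open>O(dt)\<close> perturbation of the identity.
\<close>

section \<open>Asymptotic estimates for small linear perturbations\<close>

text \<open>
  In the sum norm the matrix \<open>A\<close> eventually has norm at most 1/2, so the solution is at most twice
  the residual. This controls the implicit linear systems of the stages and of the update alike.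
\<close>

lemma bigo_absorb_small_linear:
  fixes x :: "'n::finite \<Rightarrow> 'a \<Rightarrow> real"
  assumes small: "\<And>k l. A k l \<in> o[G](\<lambda>_. 1)"
    and residual: "\<And>k. (\<lambda>t. x k t - (\<Sum>l\<in>UNIV. A k l t * x l t)) \<in> O[G](g)"
  shows "x k \<in> O[G](g)"
proof -
  define N where "N = real CARD('n)"
  define r where "r k t = x k t - (\<Sum>l\<in>UNIV. A k l t * x l t)" for k t
  have N: "0 < N"
    unfolding N_def by simp
  \<comment> \<open>Entries below \<open>1 / (2 * N)\<close> make each row absorb \<open>S / (2 * N)\<close>, hence all \<open>N\<close> rows half of \<open>S\<close>.\<close>
  have "\<forall>\<^sub>F t in G. \<bar>A k l t\<bar> \<le> 1 / (2 * N)" for k l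
    using landau_o.smallD[OF small[of k l], of "1 / (2 * N)"] N by simp
  then have "\<forall>\<^sub>F t in G. \<forall>k l. \<bar>A k l t\<bar> \<le> 1 / (2 * N)"
    by (simp add: eventually_all_finite)
  then have bound: "\<forall>\<^sub>F t in G. norm (x k t) \<le> 2 * norm (\<Sum>k\<in>UNIV. \<bar>r k t\<bar>)"
  proof eventually_elim
    case (elim t)
    define S where "S = (\<Sum>l\<in>UNIV. \<bar>x l t\<bar>)"
    have row: "\<bar>x k t\<bar> \<le> \<bar>r k t\<bar> + S / (2 * N)" for k
    proof -
      have "\<bar>x k t\<bar> \<le> \<bar>r k t\<bar> + \<bar>\<Sum>l\<in>UNIV. A k l t * x l t\<bar>"
        unfolding r_def by linarith
      also have "\<bar>\<Sum>l\<in>UNIV. A k l t * x l t\<bar> \<le> (\<Sum>l\<in>UNIV. \<bar>A k l t * x l t\<bar>)"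
        by (rule sum_abs)
      also have "\<dots> \<le> (\<Sum>l\<in>UNIV. 1 / (2 * N) * \<bar>x l t\<bar>)"
        unfolding abs_mult using elim by (intro sum_mono mult_right_mono) auto
      also have "\<dots> = S / (2 * N)"
        unfolding S_def by (simp add: sum_divide_distrib)
      finally show ?thesis
        by simp
    qed
    have "S \<le> (\<Sum>k\<in>UNIV. \<bar>r k t\<bar> + S / (2 * N))"
      unfolding S_def using row by (intro sum_mono) (simp add: S_def)
    also have "\<dots> = (\<Sum>k\<in>UNIV. \<bar>r k t\<bar>) + S / 2"
      using N by (simp add: sum.distrib N_def)
    finally have "S \<le> 2 * (\<Sum>k\<in>UNIV. \<bar>r k t\<bar>)"
      by simp
    moreover have "\<bar>x k t\<bar> \<le> S"
      unfolding S_def by (rule member_le_sum) auto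
    ultimately show ?case
      by (simp add: sum_nonneg)
  qed
  have "(\<lambda>t. \<Sum>k\<in>UNIV. \<bar>r k t\<bar>) \<in> O[G](g)"
    using residual by (intro big_sum_in_bigo) (simp add: r_def)
  with landau_o.bigI[OF _ bound] show ?thesis
    by (meson landau_o.big.trans zero_less_numeral)
qed

lemma bigo_one_if_tendsto:
  fixes f :: "'a \<Rightarrow> real"
  assumes "(f \<longlongrightarrow> c) G"
  shows "f \<in> O[G](\<lambda>_. 1)"
  using assms by (intro bigoI_tendsto[where c = c]) auto

lemma bigo_mult_bounded:
  fixes f h :: "'a \<Rightarrow> real"
  assumes "f \<in> O[G](\<lambda>_. 1)" "h \<in> O[G](g)"
  shows "(\<lambda>t. f t * h t) \<in> O[G](g)"
  using landau_o.big.mult[OF assms] by simp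

lemma step_times_bounded_smallo:
  fixes f :: "real \<Rightarrow> real"
  assumes "f \<in> O[at_right 0](\<lambda>_. 1)"
  shows "(\<lambda>dt. dt * f dt) \<in> o[at_right 0](\<lambda>_. 1)"
proof -
  have "(\<lambda>dt::real. dt) \<in> o[at_right 0](\<lambda>_. 1)"
    by (rule smalloI_tendsto) (auto intro!: tendsto_eq_intros)
  from landau_o.small_big_mult[OF this assms] show ?thesis
    by simp
qed

lemma bigo_eventually_eq:
  assumes "f \<in> O[G](g)" "\<forall>\<^sub>F t in G. f t = h t"
  shows "h \<in> O[G](g)"
  using landau_o.big.in_cong[OF assms(2)] assms(1) by blast

lemma step_mult_bigo_power:
  fixes f :: "real \<Rightarrow> real"
  assumes "f \<in> O[at_right 0](\<lambda>dt. dt ^ q)"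
  shows "(\<lambda>dt. dt * f dt) \<in> O[at_right 0](\<lambda>dt. dt ^ (q + 1))"
  using landau_o.big.mult_left[OF assms, of "\<lambda>dt. dt"] by simp

lemma step_power_bigo:
  "(\<lambda>dt::real. dt ^ (q + 1)) \<in> O[at_right 0](\<lambda>dt. dt ^ q)"
proof -
  have "(\<lambda>dt::real. dt) \<in> O[at_right 0](\<lambda>_. 1)"
    by (rule bigo_one_if_tendsto[where c = 0]) (auto intro!: tendsto_eq_intros)
  from bigo_mult_bounded[OF this landau_o.big_refl] show ?thesis
    by simp
qed

lemma bigo_power_tendsto_zero:
  fixes f :: "real \<Rightarrow> real"
  assumes "f \<in> O[at_right 0](\<lambda>dt. dt ^ q)" "1 \<le> q"
  shows "(f \<longlongrightarrow> 0) (at_right 0)"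
proof -
  have "(\<lambda>dt::real. dt ^ q) \<in> o[at_right 0](\<lambda>_. 1)"
    using assms(2) by (intro smalloI_tendsto) (auto intro!: tendsto_eq_intros)
  from landau_o.big_small_trans[OF assms(1) this] show ?thesis
    using smalloD_tendsto by fastforce
qed

section \<open>The Patankar-weighted right-hand side as an affine map\<close>

text \<open>
  The linear part of \<open>patankar_rhs\<close> as a function of the ratios \<open>v $ l / s $ l\<close>.
\<close>
definition patankar_matrix :: "'n::finite pdrs \<Rightarrow> real ^ 'n \<Rightarrow> 'n \<Rightarrow> 'n \<Rightarrow> real" where
  "patankar_matrix F y k l =
     prd F y $ k $ l - (if l = k then rdest F y $ k + (\<Sum>i\<in>UNIV. dst F y $ k $ i) else 0)"

lemma patankar_rhs_affine:
  "patankar_rhs F y s v k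
     = rprod F y $ k + (\<Sum>l\<in>UNIV. patankar_matrix F y k l * (v $ l / s $ l))"
proof -
  have "(\<Sum>l\<in>UNIV. patankar_matrix F y k l * (v $ l / s $ l))
    = (\<Sum>l\<in>UNIV. prd F y $ k $ l * (v $ l / s $ l))
      - (\<Sum>l\<in>UNIV. if l = k then (rdest F y $ k + (\<Sum>i\<in>UNIV. dst F y $ k $ i)) * (v $ k / s $ k) else 0)"
    unfolding patankar_matrix_def sum_subtractf[symmetric]
    by (intro sum.cong) (auto simp: left_diff_distrib simp del: times_divide_eq_right)
  then show ?thesis
    unfolding patankar_rhs_def by simp
qed

lemma weighted_sum_patankar_rhs:
  "(\<Sum>j\<in>J. c j * patankar_rhs F (Y j) s v k)
     = (\<Sum>j\<in>J. c j * rprod F (Y j) $ k)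
       + (\<Sum>l\<in>UNIV. (\<Sum>j\<in>J. c j * patankar_matrix F (Y j) k l) * (v $ l / s $ l))"
proof -
  have "(\<Sum>j\<in>J. c j * (\<Sum>l\<in>UNIV. patankar_matrix F (Y j) k l * (v $ l / s $ l)))
      = (\<Sum>l\<in>UNIV. \<Sum>j\<in>J. c j * patankar_matrix F (Y j) k l * (v $ l / s $ l))"
    by (subst sum.swap) (simp add: sum_distrib_left mult.assoc)
  then show ?thesis
    unfolding patankar_rhs_affine by (simp only: distrib_left sum.distrib sum_distrib_right)
qed

section \<open>Behaviour near the initial value\<close>

lemma smooth_on_imp_continuous_on: "smooth_on m f S \<Longrightarrow> continuous_on S f"
  unfolding smooth_on_def by (metis Ck_on.simps(1) i0_lb zero_enat_def)

lemma eventually_in_pos_orthant: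
  fixes y :: "'a \<Rightarrow> real ^ 'n::finite"
  assumes lim: "(y \<longlongrightarrow> z) G" and z: "z \<in> pos_orthant"
  shows "\<forall>\<^sub>F t in G. y t \<in> pos_orthant"
proof -
  have "\<forall>\<^sub>F t in G. 0 < y t $ k" for k
    using tendsto_vec_nth[OF lim] z by (intro order_tendstoD(1)) (auto simp: pos_orthant_def)
  then show ?thesis
    by (simp add: pos_orthant_def eventually_all_finite)
qed

text \<open>
  Boundedness comes from continuity at the interior point \<open>z\<close>; near the boundary of the orthant
  the coefficients need not be bounded, which is why convergence of the stages must be shown first.
\<close>
lemma patankar_coefficients_bounded:
  fixes y :: "'a \<Rightarrow> real ^ 'n::finite"
  assumes system: "pdr_system m F" and z: "z \<in> pos_orthant" and lim: "(y \<longlongrightarrow> z) G"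
  shows "(\<lambda>t. rprod F (y t) $ k) \<in> O[G](\<lambda>_. 1)"
    and "(\<lambda>t. patankar_matrix F (y t) k l) \<in> O[G](\<lambda>_. 1)"
proof -
  have conv: "((\<lambda>t. f (y t)) \<longlongrightarrow> f z) G" if "smooth_on m f pos_orthant" for f :: "real ^ 'n \<Rightarrow> real"
    using smooth_on_imp_continuous_on[OF that] lim z eventually_in_pos_orthant[OF lim z]
    by (rule continuous_on_tendsto_compose)
  have smooth: "smooth_on m (\<lambda>v. rprod F v $ k) pos_orthant"
    "smooth_on m (\<lambda>v. rdest F v $ k) pos_orthant"
    "smooth_on m (\<lambda>v. prd F v $ k $ l) pos_orthant"
    "smooth_on m (\<lambda>v. dst F v $ k $ l) pos_orthant" for k l
    using system unfolding pdr_system_def by auto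
  show "(\<lambda>t. rprod F (y t) $ k) \<in> O[G](\<lambda>_. 1)"
    by (rule bigo_one_if_tendsto[OF conv[OF smooth(1)]])
  have "((\<lambda>t. patankar_matrix F (y t) k l) \<longlongrightarrow> patankar_matrix F z k l) G"
    unfolding patankar_matrix_def
    by (cases "l = k") (simp_all, (intro tendsto_intros conv smooth)+)
  then show "(\<lambda>t. patankar_matrix F (y t) k l) \<in> O[G](\<lambda>_. 1)"
    by (rule bigo_one_if_tendsto)
qed

text \<open>
  Convergence in the product topology, the form in which the continuity assumption on the
  Patankar-weight denominators is stated.
\<close>
lemma tendsto_fun_componentwise:
  fixes f :: "'a \<Rightarrow> 'i \<Rightarrow> 'b::topological_space"
  assumes "\<And>i. ((\<lambda>t. f t i) \<longlongrightarrow> z i) G"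
  shows "(f \<longlongrightarrow> z) G"
proof -
  have "limitin (product_topology (\<lambda>_::'i. euclidean :: 'b topology) UNIV) f z G"
    unfolding limitin_componentwise using assms by auto
  then show ?thesis
    by (simp add: euclidean_product_topology)
qed

text \<open>
  Only the stages before \<open>i\<close> are known to converge when this is used, whereas positivity and
  continuity of the denominators speak about complete sequences in the orthant. Since the denominators
  see the earlier stages only, the later entries may be replaced by the constant \<open>un\<close>.
\<close>
lemma pden_tendsto:
  fixes M :: "'n::finite mprk"
  assumes scheme: "mprk_method m V M" and i: "i \<in> {1..nstages M}" and un: "un \<in> pos_orthant"
    and lim: "\<And>j. j \<in> {1..<i} \<Longrightarrow> ((\<lambda>dt. Y dt j) \<longlongrightarrow> un) G"
  shows "((\<lambda>dt. pden M i un (Y dt)) \<longlongrightarrow> pden M i un (\<lambda>_. un)) G"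
    and "pden M i un (\<lambda>_. un) \<in> pos_orthant"
proof -
  define Z where "Z dt j = (if j \<in> {1..<i} then Y dt j else un)" for dt j
  have local: "pden M i un (Y dt) = pden M i un (Z dt)" for dt
    using scheme i unfolding mprk_method_def Z_def by auto
  have pos: "\<And>Y. (\<And>j. Y j \<in> pos_orthant) \<Longrightarrow> pden M i un Y \<in> pos_orthant"
    using scheme i un unfolding mprk_method_def by auto
  then show "pden M i un (\<lambda>_. un) \<in> pos_orthant"
    using un by auto
  have cont: "continuous_on (pos_orthant \<times> {Y. \<forall>j. Y j \<in> pos_orthant}) (\<lambda>(un, Y). pden M i un Y)"
    using scheme i unfolding mprk_method_def by auto
  have Zlim: "((\<lambda>dt. Z dt j) \<longlongrightarrow> un) G" for j
    using lim[of j] unfolding Z_def by (cases "j \<in> {1..<i}") (simp_all only: if_True if_False tendsto_const)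
  have "\<forall>\<^sub>F dt in G. \<forall>j\<in>{1..<i}. Y dt j \<in> pos_orthant"
    using eventually_in_pos_orthant[OF lim un] by (intro eventually_ball_finite) auto
  then have ev: "\<forall>\<^sub>F dt in G. (un, Z dt) \<in> pos_orthant \<times> {Y. \<forall>j. Y j \<in> pos_orthant}"
    by eventually_elim (use un in \<open>auto simp: Z_def\<close>)
  have "((\<lambda>dt. (un, Z dt)) \<longlongrightarrow> (un, \<lambda>_. un)) G"
    by (intro tendsto_Pair tendsto_const tendsto_fun_componentwise Zlim)
  from continuous_on_tendsto_compose[OF cont this _ ev] un
  show "((\<lambda>dt. pden M i un (Y dt)) \<longlongrightarrow> pden M i un (\<lambda>_. un)) G"
    unfolding local by simp
qed

text \<open>
  If the earlier stages converge, the denominators have a positive limit and the stage equation has the form \<open>Y i = un + dt * (R + A Y i)\<close> with bounded \<open>R\<close> and \<open>A\<close>. Absorbing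
  \<open>dt * A\<close> first shows that \<open>Y i\<close> is bounded; then the whole increment is \<open>O(dt)\<close>, so \<open>Y i\<close>
  tends to \<open>un\<close>.
\<close>
lemma stages_tendsto:
  fixes M :: "'n::finite mprk"
  assumes system: "pdr_system m F" and scheme: "mprk_method m V M" and un: "un \<in> pos_orthant"
    and stages: "\<forall>\<^sub>F dt in at_right 0. mprk_stages M F dt un (Y dt)"
    and i: "i \<in> {1..nstages M}"
  shows "((\<lambda>dt. Y dt i) \<longlongrightarrow> un) (at_right 0)"
  using i
proof (induction i rule: less_induct)
  case (less i)
  define \<pi> where "\<pi> dt = pden M i un (Y dt)" for dt
  define R where "R k dt = (\<Sum>j\<in>{1..<i}. acoeff M i j * rprod F (Y dt j) $ k)" for k dt
  define A where
    "A k l dt = (\<Sum>j\<in>{1..<i}. acoeff M i j * patankar_matrix F (Y dt j) k l) * (1 / \<pi> dt $ l)" for k l dt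
  have lim: "((\<lambda>dt. Y dt j) \<longlongrightarrow> un) (at_right 0)" if "j \<in> {1..<i}" for j
    using less that by auto
  note coeff = patankar_coefficients_bounded[OF system un lim]
  have \<pi>lim: "(\<pi> \<longlongrightarrow> pden M i un (\<lambda>_. un)) (at_right 0)"
    and \<pi>pos: "pden M i un (\<lambda>_. un) \<in> pos_orthant"
    unfolding \<pi>_def using pden_tendsto[OF scheme less.prems un lim] by auto
  have R: "R k \<in> O[at_right 0](\<lambda>_. 1)" for k
    unfolding R_def by (intro big_sum_in_bigo bigo_mult_bounded coeff) auto
  have "((\<lambda>dt. 1 / \<pi> dt $ l) \<longlongrightarrow> 1 / pden M i un (\<lambda>_. un) $ l) (at_right 0)" for l
    using \<pi>pos by (intro tendsto_intros \<pi>lim) (auto simp: pos_orthant_def less_imp_neq[symmetric])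
  then have A: "A k l \<in> O[at_right 0](\<lambda>_. 1)" for k l
    unfolding A_def
    by (intro big_sum_in_bigo bigo_mult_bounded coeff bigo_one_if_tendsto) auto
  have eq: "\<forall>\<^sub>F dt in at_right 0. \<forall>k. Y dt i $ k
      = un $ k + dt * (R k dt + (\<Sum>l\<in>UNIV. A k l dt * Y dt i $ l))"
    using stages
  proof eventually_elim
    case (elim dt)
    show ?case
    proof
      fix k
      have "Y dt i $ k = un $ k
          + dt * (\<Sum>j\<in>{1..<i}. acoeff M i j * patankar_rhs F (Y dt j) (\<pi> dt) (Y dt i) k)"
        using elim less.prems unfolding mprk_stages_def \<pi>_def by blast
      also have "(\<Sum>j\<in>{1..<i}. acoeff M i j * patankar_rhs F (Y dt j) (\<pi> dt) (Y dt i) k)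
          = R k dt + (\<Sum>l\<in>UNIV. A k l dt * Y dt i $ l)"
        unfolding weighted_sum_patankar_rhs R_def A_def by (simp add: mult.assoc)
      finally show "Y dt i $ k
          = un $ k + dt * (R k dt + (\<Sum>l\<in>UNIV. A k l dt * Y dt i $ l))" .
    qed
  qed
  have Ybounded: "(\<lambda>dt. Y dt i $ k) \<in> O[at_right 0](\<lambda>_. 1)" for k
  proof (rule bigo_absorb_small_linear[where x = "\<lambda>k dt. Y dt i $ k" and A = "\<lambda>k l dt. dt * A k l dt"])
    fix k
    have "(\<lambda>dt. un $ k + dt * R k dt) \<in> O[at_right 0](\<lambda>_. 1)"
      by (intro sum_in_bigo(1) bigo_one_if_tendsto[OF tendsto_const]
          landau_o.small_imp_big[OF step_times_bounded_smallo[OF R]])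
    moreover have "\<forall>\<^sub>F dt in at_right 0. un $ k + dt * R k dt
        = Y dt i $ k - (\<Sum>l\<in>UNIV. dt * A k l dt * Y dt i $ l)"
      using eq
    proof eventually_elim
      case (elim dt)
      from elim[rule_format, of k] show ?case
        by (simp add: distrib_left sum_distrib_left mult.assoc)
    qed
    ultimately show "(\<lambda>dt. Y dt i $ k - (\<Sum>l\<in>UNIV. dt * A k l dt * Y dt i $ l)) \<in> O[at_right 0](\<lambda>_. 1)"
      by (rule bigo_eventually_eq)
  qed (intro step_times_bounded_smallo A)
  show ?case
  proof (rule vec_tendstoI)
    fix k
    have "(\<lambda>dt. R k dt + (\<Sum>l\<in>UNIV. A k l dt * Y dt i $ l)) \<in> O[at_right 0](\<lambda>_. 1)"
      by (intro sum_in_bigo R big_sum_in_bigo bigo_mult_bounded A Ybounded)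
    from smalloD_tendsto[OF step_times_bounded_smallo[OF this]]
    have "((\<lambda>dt. un $ k + dt * (R k dt + (\<Sum>l\<in>UNIV. A k l dt * Y dt i $ l))) \<longlongrightarrow> un $ k + 0) (at_right 0)"
      by (intro tendsto_intros) simp
    moreover have "\<forall>\<^sub>F dt in at_right 0.
        un $ k + dt * (R k dt + (\<Sum>l\<in>UNIV. A k l dt * Y dt i $ l)) = Y dt i $ k"
      using eq by (rule eventually_mono) (rule sym, erule spec)
    ultimately show "((\<lambda>dt. Y dt i $ k) \<longlongrightarrow> un $ k) (at_right 0)"
      using Lim_transform_eventually by simp
  qed
qed

lemma exact_solution_tendsto:
  assumes "exact_solution F tn T un u"
  shows "((\<lambda>dt. u (tn + dt)) \<longlongrightarrow> un) (at_right 0)"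
proof -
  have T: "0 < T" and un: "u tn = un"
    and "(u has_vector_derivative pdrs_rhs F (u tn)) (at tn within {tn..tn + T})"
    using assms unfolding exact_solution_def by auto
  then have "(u \<longlongrightarrow> un) (at tn within {tn..tn + T})"
    using has_vector_derivative_continuous continuous_within by blast
  then have "(u \<longlongrightarrow> un) (at_right tn)"
    using T by (simp add: at_within_Icc_at_right)
  then show ?thesis
    by (subst (asm) filterlim_at_right_to_0) (simp add: add.commute)
qed

section \<open>Dense output of order \<open>p\<close>\<close>

text \<open>
  Below, \<open>R\<close> and \<open>Q\<close> are the coefficients of the update, common to all parameters, and \<open>x g\<close> is
  the deviation of the Patankar weights from 1.
\<close>
theorem lemma4:
  fixes F :: "'n::finite pdrs"
    and M :: "'n mprk"
    and m :: enat
    and p :: nat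
    and V :: "real set"
    and tn T :: real
    and un :: "real ^ 'n"
    and u :: "real \<Rightarrow> real ^ 'n"
    and Y :: "real \<Rightarrow> nat \<Rightarrow> real ^ 'n"
    and w :: "real \<Rightarrow> real \<Rightarrow> real ^ 'n"
  assumes system: "pdr_system m F"
    and initial: "un \<in> pos_orthant"
    and solution: "exact_solution F tn T un u"
    and nbhd: "1 \<in> interior V"
    and scheme: "mprk_method m V M"
    and bbar: "\<And>\<gamma> j. \<gamma> \<in> V \<Longrightarrow> j \<in> {1..nstages M} \<Longrightarrow> bbar M \<gamma> j = \<gamma> * bcoeff M j"
    and p_pos: "1 \<le> p"
    and order: "baseline_order m M p"
    and stages: "\<forall>\<^sub>F dt in at_right 0. mprk_stages M F dt un (Y dt)"
    and update: "\<And>\<gamma>. \<gamma> \<in> V \<Longrightarrow> \<forall>\<^sub>F dt in at_right 0. mprk_update M \<gamma> F dt un (Y dt) (w \<gamma> dt)"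
    and sigma: "\<And>\<gamma> k. \<gamma> \<in> V \<Longrightarrow>
      (\<lambda>dt. sden M \<gamma> F dt un $ k
          - (u (tn + dt) $ k + (\<gamma> - 1) * (u (tn + dt) $ k - u tn $ k)))
        \<in> O[at_right 0](\<lambda>dt. dt ^ p)"
  shows "\<forall>\<gamma>\<in>V. \<forall>k.
      (\<lambda>dt. w \<gamma> dt $ k / sden M \<gamma> F dt un $ k - 1) \<in> O[at_right 0](\<lambda>dt. dt ^ p) \<and>
      (\<lambda>dt. w \<gamma> dt $ k / sden M \<gamma> F dt un $ k - w 1 dt $ k / sden M 1 F dt un $ k)
        \<in> O[at_right 0](\<lambda>dt. dt ^ p) \<and>
      (\<lambda>dt. w \<gamma> dt $ k - (w 1 dt $ k + (\<gamma> - 1) * (w 1 dt $ k - un $ k)))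
        \<in> O[at_right 0](\<lambda>dt. dt ^ (p + 1))"
proof (intro ballI allI)
  fix \<gamma> :: real and k :: 'n
  assume \<gamma>: "\<gamma> \<in> V"
  let ?O = "\<lambda>q. O[at_right 0](\<lambda>dt::real. dt ^ q)"
  define \<sigma> where "\<sigma> g k dt = sden M g F dt un $ k" for g k dt
  define x where "x g k dt = w g dt $ k / \<sigma> g k dt - 1" for g k dt
  define R where "R k dt = (\<Sum>j\<in>{1..nstages M}. bcoeff M j * rprod F (Y dt j) $ k)" for k dt
  define Q where
    "Q k l dt = (\<Sum>j\<in>{1..nstages M}. bcoeff M j * patankar_matrix F (Y dt j) k l)" for k l dt
  have V1: "1 \<in> V"
    using nbhd interior_subset by blast
  have u0: "u tn = un"
    using solution by (simp add: exact_solution_def)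
  have Q: "Q k l \<in> O[at_right 0](\<lambda>_. 1)" for k l
    unfolding Q_def
    using patankar_coefficients_bounded[OF system initial stages_tendsto[OF system scheme initial stages]]
    by (intro big_sum_in_bigo) simp

  have Q_sum: "(\<lambda>dt. \<gamma> * (\<Sum>l\<in>UNIV. Q k l dt * f l dt)) \<in> ?O p" if "\<And>l. f l \<in> ?O p" for f k
    unfolding cmult_in_bigo_iff by (intro disjI2 big_sum_in_bigo bigo_mult_bounded Q that)

  have weaken: "f \<in> ?O p" if "f \<in> ?O (p + 1)" for f
    using landau_o.big.trans[OF that step_power_bigo] by simp
  \<comment> \<open>The denominators stay away from 0: the extrapolated solution tends to \<open>un\<close>, and the error
    \<open>O(dt ^ p)\<close> vanishes in the limit because \<open>p\<close> is positive.\<close>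
  have \<sigma>_lim: "(\<sigma> g k \<longlongrightarrow> un $ k) (at_right 0)" if g: "g \<in> V" for g k
  proof -
    have "((\<lambda>dt. \<sigma> g k dt - (u (tn + dt) $ k + (g - 1) * (u (tn + dt) $ k - u tn $ k))) \<longlongrightarrow> 0) (at_right 0)"
      unfolding \<sigma>_def using sigma[OF g] p_pos by (rule bigo_power_tendsto_zero)
    moreover have "((\<lambda>dt. u (tn + dt) $ k + (g - 1) * (u (tn + dt) $ k - u tn $ k))
        \<longlongrightarrow> un $ k + (g - 1) * (un $ k - u tn $ k)) (at_right 0)"
      by (intro tendsto_intros exact_solution_tendsto[OF solution])
    ultimately show ?thesis
      using tendsto_add u0 by fastforce
  qed
  have un_pos: "0 < un $ k" for k
    using initial by (simp add: pos_orthant_def)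
  have inv_\<sigma>: "(\<lambda>dt. 1 / \<sigma> g k dt) \<in> O[at_right 0](\<lambda>_. 1)" if "g \<in> V" for g k
    using un_pos[of k]
    by (intro bigo_one_if_tendsto[where c = "1 / un $ k"] tendsto_intros \<sigma>_lim that) auto
  have \<sigma>_pos: "\<forall>\<^sub>F dt in at_right 0. \<forall>k. 0 < \<sigma> g k dt" if "g \<in> V" for g
    using order_tendstoD(1)[OF \<sigma>_lim[OF that] un_pos] by (simp add: eventually_all_finite)
  have upd: "\<forall>\<^sub>F dt in at_right 0. \<forall>k. w g dt $ k
      = un $ k + dt * (g * (R k dt + (\<Sum>l\<in>UNIV. Q k l dt * (1 + x g l dt))))"
    if g: "g \<in> V" for g
    using update[OF g]
  proof eventually_elim
    case (elim dt)
    show ?case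
    proof
      fix k
      have "w g dt $ k = un $ k + dt *
          (\<Sum>j\<in>{1..nstages M}. bbar M g j * patankar_rhs F (Y dt j) (sden M g F dt un) (w g dt) k)"
        using elim unfolding mprk_update_def by blast
      also have "(\<Sum>j\<in>{1..nstages M}. bbar M g j * patankar_rhs F (Y dt j) (sden M g F dt un) (w g dt) k)
          = g * (\<Sum>j\<in>{1..nstages M}. bcoeff M j * patankar_rhs F (Y dt j) (sden M g F dt un) (w g dt) k)"
        unfolding sum_distrib_left using bbar[OF g] by (intro sum.cong) auto
      also have "\<dots> = g * (R k dt + (\<Sum>l\<in>UNIV. Q k l dt * (1 + x g l dt)))"
        by (simp add: weighted_sum_patankar_rhs R_def Q_def x_def \<sigma>_def)
      finally show "w g dt $ k = un $ k + dt * (g * (R k dt + (\<Sum>l\<in>UNIV. Q k l dt * (1 + x g l dt))))" .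
    qed
  qed

  have baseline: "(\<lambda>dt. w 1 dt $ k - u (tn + dt) $ k) \<in> ?O (p + 1)" for k
    using order system initial solution eventually_conj[OF stages update[OF V1]]
    unfolding baseline_order_def by blast
  \<comment> \<open>Both \<open>w 1\<close> and \<open>\<sigma> 1\<close> are compared with the exact solution.\<close>
  have x1: "x 1 k \<in> ?O p" for k
  proof -
    have "(\<lambda>dt. (w 1 dt $ k - u (tn + dt) $ k) - (\<sigma> 1 k dt - u (tn + dt) $ k)) \<in> ?O p"
      using sigma[OF V1, of k] by (intro sum_in_bigo(2)[OF weaken[OF baseline]]) (simp add: \<sigma>_def)
    then have "(\<lambda>dt. 1 / \<sigma> 1 k dt * (w 1 dt $ k - \<sigma> 1 k dt)) \<in> ?O p"
      by (intro bigo_mult_bounded inv_\<sigma> V1) simp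
    moreover have "\<forall>\<^sub>F dt in at_right 0. 1 / \<sigma> 1 k dt * (w 1 dt $ k - \<sigma> 1 k dt) = x 1 k dt"
      using \<sigma>_pos[OF V1] by eventually_elim (simp add: x_def field_simps less_imp_neq[symmetric])
    ultimately show ?thesis
      by (rule bigo_eventually_eq)
  qed

  \<comment> \<open>Proportional weights: subtracting \<open>\<gamma>\<close> times the baseline equation cancels \<open>R\<close> and the
    constant 1 in \<open>1 + x g l\<close>.\<close>
  have diff: "\<forall>\<^sub>F dt in at_right 0. \<forall>k. w \<gamma> dt $ k - (w 1 dt $ k + (\<gamma> - 1) * (w 1 dt $ k - un $ k))
      = dt * (\<gamma> * (\<Sum>l\<in>UNIV. Q k l dt * (x \<gamma> l dt - x 1 l dt)))"
    using upd[OF V1] upd[OF \<gamma>]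
  proof eventually_elim
    case (elim dt)
    show ?case
    proof
      fix k
      define S where "S g = (\<Sum>l\<in>UNIV. Q k l dt * (1 + x g l dt))" for g
      have "(\<Sum>l\<in>UNIV. Q k l dt * (x \<gamma> l dt - x 1 l dt)) = S \<gamma> - S 1"
        unfolding S_def by (simp add: sum_subtractf[symmetric] algebra_simps)
      moreover have "w 1 dt $ k = un $ k + dt * (1 * (R k dt + S 1))"
        and "w \<gamma> dt $ k = un $ k + dt * (\<gamma> * (R k dt + S \<gamma>))"
        using elim unfolding S_def by blast+
      ultimately show "w \<gamma> dt $ k - (w 1 dt $ k + (\<gamma> - 1) * (w 1 dt $ k - un $ k))
          = dt * (\<gamma> * (\<Sum>l\<in>UNIV. Q k l dt * (x \<gamma> l dt - x 1 l dt)))"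
        by (simp only:) (simp add: algebra_simps)
    qed
  qed

  have x\<gamma>: "x \<gamma> k \<in> ?O p" for k
  proof (rule bigo_absorb_small_linear[where A = "\<lambda>k l dt. dt * (1 / \<sigma> \<gamma> k dt * (\<gamma> * Q k l dt))"])
    show "(\<lambda>dt. dt * (1 / \<sigma> \<gamma> k dt * (\<gamma> * Q k l dt))) \<in> o[at_right 0](\<lambda>_. 1)" for k l
      using Q by (intro step_times_bounded_smallo bigo_mult_bounded inv_\<sigma> \<gamma>) simp
    fix k
    \<comment> \<open>The first two terms add up to \<open>un + \<gamma> * (w 1 - un) - \<sigma> \<gamma>\<close>, the distance of the
      extrapolated baseline from the denominator; the last one is the known part of the sum in
      \<open>diff\<close>.\<close>
    define E where
      "E dt = \<gamma> * (w 1 dt $ k - u (tn + dt) $ k)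
         - (\<sigma> \<gamma> k dt - (u (tn + dt) $ k + (\<gamma> - 1) * (u (tn + dt) $ k - u tn $ k)))
         - dt * (\<gamma> * (\<Sum>l\<in>UNIV. Q k l dt * x 1 l dt))" for dt
    have "(\<lambda>dt. dt * (\<gamma> * (\<Sum>l\<in>UNIV. Q k l dt * x 1 l dt))) \<in> ?O p"
      by (intro weaken step_mult_bigo_power Q_sum x1)
    note response = this
    have "(\<lambda>dt. \<gamma> * (w 1 dt $ k - u (tn + dt) $ k)) \<in> ?O p"
      unfolding cmult_in_bigo_iff using weaken[OF baseline] by (rule disjI2)
    from sum_in_bigo(2)[OF sum_in_bigo(2)[OF this sigma[OF \<gamma>]] response]
    have "E \<in> ?O p"
      unfolding E_def \<sigma>_def .
    then have "(\<lambda>dt. 1 / \<sigma> \<gamma> k dt * E dt) \<in> ?O p"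
      by (intro bigo_mult_bounded inv_\<sigma> \<gamma>)
    moreover have "\<forall>\<^sub>F dt in at_right 0. 1 / \<sigma> \<gamma> k dt * E dt
        = x \<gamma> k dt - (\<Sum>l\<in>UNIV. dt * (1 / \<sigma> \<gamma> k dt * (\<gamma> * Q k l dt)) * x \<gamma> l dt)"
      using \<sigma>_pos[OF \<gamma>] diff
    proof eventually_elim
      case (elim dt)
      have "\<sigma> \<gamma> k dt \<noteq> 0"
        using elim(1)[rule_format, of k] by simp
      then have w_eq: "w \<gamma> dt $ k = \<sigma> \<gamma> k dt + \<sigma> \<gamma> k dt * x \<gamma> k dt"
        by (simp add: x_def right_diff_distrib)
      define S where "S g = (\<Sum>l\<in>UNIV. Q k l dt * x g l dt)" for g
      have "(\<Sum>l\<in>UNIV. Q k l dt * (x \<gamma> l dt - x 1 l dt)) = S \<gamma> - S 1"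
        unfolding S_def by (simp add: sum_subtractf right_diff_distrib)
      with elim(2) have "w \<gamma> dt $ k - (w 1 dt $ k + (\<gamma> - 1) * (w 1 dt $ k - un $ k))
          = dt * (\<gamma> * (S \<gamma> - S 1))"
        by metis
      then have "E dt = \<sigma> \<gamma> k dt * x \<gamma> k dt - dt * (\<gamma> * S \<gamma>)"
        unfolding E_def u0 w_eq S_def[symmetric] by (simp add: algebra_simps)
      then have "1 / \<sigma> \<gamma> k dt * E dt = x \<gamma> k dt - dt * (1 / \<sigma> \<gamma> k dt * (\<gamma> * S \<gamma>))"
        using \<open>\<sigma> \<gamma> k dt \<noteq> 0\<close> by (simp add: right_diff_distrib diff_divide_distrib)
      then show ?case
        unfolding S_def sum_distrib_left by (simp only: mult.assoc)
    qed
    ultimately show "(\<lambda>dt. x \<gamma> k dt - (\<Sum>l\<in>UNIV. dt * (1 / \<sigma> \<gamma> k dt * (\<gamma> * Q k l dt)) * x \<gamma> l dt)) \<in> ?O p"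
      by (rule bigo_eventually_eq)
  qed

  have x_diff: "(\<lambda>dt. x \<gamma> k dt - x 1 k dt) \<in> ?O p" for k
    by (intro sum_in_bigo x\<gamma> x1)
  \<comment> \<open>Back in \<open>diff\<close>, the explicit factor \<open>dt\<close> raises the order by one.\<close>
  have "(\<lambda>dt. dt * (\<gamma> * (\<Sum>l\<in>UNIV. Q k l dt * (x \<gamma> l dt - x 1 l dt)))) \<in> ?O (p + 1)"
    by (intro step_mult_bigo_power Q_sum x_diff)
  moreover have "\<forall>\<^sub>F dt in at_right 0. dt * (\<gamma> * (\<Sum>l\<in>UNIV. Q k l dt * (x \<gamma> l dt - x 1 l dt)))
      = w \<gamma> dt $ k - (w 1 dt $ k + (\<gamma> - 1) * (w 1 dt $ k - un $ k))"
    using diff by eventually_elim metis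
  ultimately have update_diff:
    "(\<lambda>dt. w \<gamma> dt $ k - (w 1 dt $ k + (\<gamma> - 1) * (w 1 dt $ k - un $ k))) \<in> ?O (p + 1)"
    by (rule bigo_eventually_eq)
  have x_eq: "x g k = (\<lambda>dt. w g dt $ k / sden M g F dt un $ k - 1)" for g
    by (simp add: x_def \<sigma>_def fun_eq_iff)
  have x_diff_eq: "(\<lambda>dt. x \<gamma> k dt - x 1 k dt)
      = (\<lambda>dt. w \<gamma> dt $ k / sden M \<gamma> F dt un $ k - w 1 dt $ k / sden M 1 F dt un $ k)"
    by (simp add: x_eq fun_eq_iff)
  show
    "(\<lambda>dt. w \<gamma> dt $ k / sden M \<gamma> F dt un $ k - 1) \<in> ?O p \<and>
     (\<lambda>dt. w \<gamma> dt $ k / sden M \<gamma> F dt un $ k - w 1 dt $ k / sden M 1 F dt un $ k) \<in> ?O p \<and>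
     (\<lambda>dt. w \<gamma> dt $ k - (w 1 dt $ k + (\<gamma> - 1) * (w 1 dt $ k - un $ k))) \<in> ?O (p + 1)"
    using x\<gamma>[of k, unfolded x_eq] x_diff[of k, unfolded x_diff_eq] update_diff by (intro conjI)
qed

end
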